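(* Every $N$-free poset without infinite antichains is a linear sum or a disjoint sum of $N$-free posets without infinite antichains.
   Context: Posets are not necessarily finite. An antichain is a set of pairwise incomparable elements. A $4$-tuple $(a,b,c,d)$ of distinct elements of a poset $P$ is an $N$ in $P$ if $a<b$, $c<b$, $c<d$, and these are the only strict comparabilities among $a,b,c,d$. $P$ is $N$-free if it does not contain an $N$. Let $I$ be a poset with $|I|\geq 2$ and $\{P_i\}_{i\in I}$ a family of pairwise disjoint nonempty posets that are all disjoint from $I$. The lexicographical sum $\sum_{i\in I}P_i$ is the poset on $\bigcup_{i\in I}P_i$ in which $x\le y$ if and only if either there is $i\in I$ with $x,y\in P_i$ and $x\le y$ in $P_i$, or there are distinct $i,j\in I$ with $i<j$ in $I$, $x\in P_i$ and $y\in P_j$. It is called a linear sum if $I$ is totally ordered, and a disjoint sum if $I$ is an antichain.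
   Formalization: The poset is assumed to have at least two elements, since a sum over an index poset with at least two elements and nonempty summands can never be empty or a single point, so the claim fails for those two posets. *)

theory Defs
  imports Main "HOL-Library.Disjoint_Sets"
begin

text \<open>
  A poset is a reflexive order relation \<open>r\<close> with \<open>Partial_order r\<close>; its underlying set is
  \<open>Field r\<close>, so two posets are equal iff the relations are.
\<close>

definition strictly_below :: "'a rel \<Rightarrow> 'a \<Rightarrow> 'a \<Rightarrow> bool" where
  "strictly_below r x y \<longleftrightarrow> (x, y) \<in> r \<and> x \<noteq> y"

definition antichain_in :: "'a rel \<Rightarrow> 'a set \<Rightarrow> bool" where
  "antichain_in r A \<longleftrightarrow>
     A \<subseteq> Field r \<and> (\<forall>x\<in>A. \<forall>y\<in>A. x \<noteq> y \<longrightarrow> (x, y) \<notin> r \<and> (y, x) \<notin> r)"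

definition no_infinite_antichain :: "'a rel \<Rightarrow> bool" where
  "no_infinite_antichain r \<longleftrightarrow> (\<forall>A. antichain_in r A \<longrightarrow> finite A)"

definition is_N :: "'a rel \<Rightarrow> 'a \<Rightarrow> 'a \<Rightarrow> 'a \<Rightarrow> 'a \<Rightarrow> bool" where
  "is_N r a b c d \<longleftrightarrow>
     {a, b, c, d} \<subseteq> Field r \<and> distinct [a, b, c, d] \<and>
     (\<forall>x\<in>{a, b, c, d}. \<forall>y\<in>{a, b, c, d}.
        strictly_below r x y \<longleftrightarrow> (x, y) \<in> {(a, b), (c, b), (c, d)})"

definition N_free :: "'a rel \<Rightarrow> bool" where
  "N_free r \<longleftrightarrow> \<not> (\<exists>a b c d. is_N r a b c d)"

definition at_least_two :: "'a set \<Rightarrow> bool" where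
  "at_least_two A \<longleftrightarrow> (\<exists>x\<in>A. \<exists>y\<in>A. x \<noteq> y)"

text \<open>
  Index poset and summands have different types in general, so no condition is needed to keep
  the summands disjoint from the index poset.
\<close>

definition lex_family :: "'i rel \<Rightarrow> ('i \<Rightarrow> 'a rel) \<Rightarrow> bool" where
  "lex_family I P \<longleftrightarrow>
     Partial_order I \<and> at_least_two (Field I) \<and>
     (\<forall>i\<in>Field I. Partial_order (P i) \<and> Field (P i) \<noteq> {}) \<and>
     disjoint_family_on (\<lambda>i. Field (P i)) (Field I)"

definition lex_sum :: "'i rel \<Rightarrow> ('i \<Rightarrow> 'a rel) \<Rightarrow> 'a rel" where
  "lex_sum I P = {(x, y).
     (\<exists>i\<in>Field I. (x, y) \<in> P i) \<or>
     (\<exists>i\<in>Field I. \<exists>j\<in>Field I.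
        strictly_below I i j \<and> x \<in> Field (P i) \<and> y \<in> Field (P j))}"

definition is_linear_sum :: "'a rel \<Rightarrow> 'i rel \<Rightarrow> ('i \<Rightarrow> 'a rel) \<Rightarrow> bool" where
  "is_linear_sum r I P \<longleftrightarrow> lex_family I P \<and> Linear_order I \<and> r = lex_sum I P"

definition is_disjoint_sum :: "'a rel \<Rightarrow> 'i rel \<Rightarrow> ('i \<Rightarrow> 'a rel) \<Rightarrow> bool" where
  "is_disjoint_sum r I P \<longleftrightarrow> lex_family I P \<and> antichain_in I (Field I) \<and> r = lex_sum I P"

lemma Field_lex_sum:
  assumes "lex_family I P"
  shows "Field (lex_sum I P) = (\<Union>i\<in>Field I. Field (P i))"
proof
  show "Field (lex_sum I P) \<subseteq> (\<Union>i\<in>Field I. Field (P i))"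
    unfolding lex_sum_def Field_def by blast
  show "(\<Union>i\<in>Field I. Field (P i)) \<subseteq> Field (lex_sum I P)"
    unfolding lex_sum_def Field_def by blast
qed

lemma Partial_order_lex_sum:
  assumes "lex_family I P"
  shows "Partial_order (lex_sum I P)"
proof -
  have F: "Field (lex_sum I P) = (\<Union>i\<in>Field I. Field (P i))"
    by (rule Field_lex_sum[OF assms])
  have I: "trans I" "antisym I"
    using assms by (auto simp: lex_family_def partial_order_on_def preorder_on_def)
  have P: "refl_on (Field (P i)) (P i)" "trans (P i)" "antisym (P i)" if "i \<in> Field I" for i
    using assms that by (auto simp: lex_family_def partial_order_on_def preorder_on_def)
  have D: "i = j" if "i \<in> Field I" "j \<in> Field I" "x \<in> Field (P i)" "x \<in> Field (P j)" for i j x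
    using assms that by (auto simp: lex_family_def disjoint_family_on_def)
  have S: "\<exists>i\<in>Field I. \<exists>j\<in>Field I. x \<in> Field (P i) \<and> y \<in> Field (P j) \<and>
      (i = j \<and> (x, y) \<in> P i \<or> i \<noteq> j \<and> (i, j) \<in> I)" if "(x, y) \<in> lex_sum I P" for x y
    using that unfolding lex_sum_def strictly_below_def by (blast intro: FieldI1 FieldI2)
  have "refl_on (Field (lex_sum I P)) (lex_sum I P)"
    unfolding F refl_on_def using P(1) by (auto simp: lex_sum_def refl_on_def)
  moreover have "antisym (lex_sum I P)"
  proof (rule antisymI)
    fix x y assume xy: "(x, y) \<in> lex_sum I P" and yx: "(y, x) \<in> lex_sum I P"
    from S[OF xy] obtain i j where ij: "i \<in> Field I" "j \<in> Field I" "x \<in> Field (P i)"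
      "y \<in> Field (P j)" "i = j \<and> (x, y) \<in> P i \<or> i \<noteq> j \<and> (i, j) \<in> I" by blast
    from S[OF yx] ij D have "i = j \<and> (y, x) \<in> P i \<or> i \<noteq> j \<and> (j, i) \<in> I" by metis
    then show "x = y" using ij I P(3) by (metis antisymD)
  qed
  moreover have "trans (lex_sum I P)"
  proof (rule transI)
    fix x y z assume xy: "(x, y) \<in> lex_sum I P" and yz: "(y, z) \<in> lex_sum I P"
    from S[OF xy] obtain i j where ij: "i \<in> Field I" "j \<in> Field I" "x \<in> Field (P i)"
      "y \<in> Field (P j)" "i = j \<and> (x, y) \<in> P i \<or> i \<noteq> j \<and> (i, j) \<in> I" by blast
    from S[OF yz] ij D obtain k where k: "k \<in> Field I" "z \<in> Field (P k)"
      "j = k \<and> (y, z) \<in> P j \<or> j \<noteq> k \<and> (j, k) \<in> I" by metis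
    have "i = k \<and> (x, z) \<in> P i \<or> i \<noteq> k \<and> (i, k) \<in> I"
      using ij k I P(2) by (metis antisymD transD)
    then show "(x, z) \<in> lex_sum I P"
      using ij k unfolding lex_sum_def strictly_below_def by blast
  qed
  moreover have "lex_sum I P \<subseteq> Field (lex_sum I P) \<times> Field (lex_sum I P)"
    by (auto intro: FieldI1 FieldI2)
  ultimately show ?thesis
    by (simp add: partial_order_on_def preorder_on_def)
qed

end

theory Submission
  imports Defs
begin

text \<open>
  An \<open>N\<close>-free poset has a comparability graph without induced four-vertex path. Suppose this graph
  is connected. Then any two vertices are at distance at most two, and hence every finite nonempty
  antichain has a common neighbour. Apply this to a maximal antichain \<open>A\<close>, which is finite: if \<open>v\<close> is
  a common neighbour of \<open>A\<close> and \<open>u\<close> is incomparable to \<open>v\<close>, then \<open>u\<close> is adjacent to some \<open>b \<in> A\<close> by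
  maximality, and if it were not adjacent to some \<open>a \<in> A\<close>, then \<open>a, v, b, u\<close> would be an induced path. So the
  set of common neighbours of \<open>A\<close> is completely joined to its complement, and such a set yields a
  cut of the order into a lower and an upper part. Consequently two summands suffice in both cases.
\<close>

section \<open>Graphs without induced four-vertex path\<close>

text \<open>For a symmetric irreflexive \<open>E\<close> this forbids exactly the induced
  four-vertex paths: \<open>a = d\<close> would turn \<open>E c d\<close> into an edge between
  \<open>a\<close> and \<open>c\<close>, and the ends of an edge differ anyway.\<close>

definition P4_free :: "('a \<Rightarrow> 'a \<Rightarrow> bool) \<Rightarrow> bool" where
  "P4_free E \<longleftrightarrow> \<not> (\<exists>a b c d. E a b \<and> E b c \<and> E c d \<and>
     a \<noteq> c \<and> b \<noteq> d \<and> \<not> E a c \<and> \<not> E b d \<and> \<not> E a d)"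

definition independent :: "'a set \<Rightarrow> ('a \<Rightarrow> 'a \<Rightarrow> bool) \<Rightarrow> 'a set \<Rightarrow> bool" where
  "independent V E A \<longleftrightarrow> A \<subseteq> V \<and> (\<forall>x\<in>A. \<forall>y\<in>A. \<not> E x y)"

text \<open>Connectedness is phrased by cuts rather than paths: its failure directly yields the
  block of a disjoint sum, and applied to a ball it yields an edge leaving the ball.\<close>

definition graph_connected :: "'a set \<Rightarrow> ('a \<Rightarrow> 'a \<Rightarrow> bool) \<Rightarrow> bool" where
  "graph_connected V E \<longleftrightarrow> (\<forall>S. S \<subset> V \<longrightarrow> S \<noteq> {} \<longrightarrow> (\<exists>x\<in>S. \<exists>y\<in>V - S. E x y))"

lemma P4_freeD:
  assumes "P4_free E" "E a b" "E b c" "E c d" "a \<noteq> c" "b \<noteq> d" "\<not> E a c" "\<not> E b d"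
  shows "E a d"
  using assms unfolding P4_free_def by blast

text \<open>The ball \<open>S\<close> of radius two around \<open>a\<close> is all of
  \<open>V\<close>. Otherwise some edge from \<open>x\<close> to \<open>y\<close> leaves it; then
  \<open>x\<close> is at distance exactly two, reached through some \<open>w\<close>, and
  \<open>a, w, x, y\<close> is an induced path.\<close>

lemma P4_free_connected_diameter:
  assumes "P4_free E" "graph_connected V E" "a \<in> V" "b \<in> V" "a \<noteq> b" "\<not> E a b"
  obtains w where "E a w" "E w b"
proof -
  define S where "S = {x \<in> V. x = a \<or> E a x \<or> (\<exists>w. E a w \<and> E w x)}"
  have "S = V"
  proof (rule ccontr)
    assume "S \<noteq> V"
    then have "S \<subset> V" "S \<noteq> {}" using assms(3) by (auto simp: S_def)
    then obtain x y where xy: "x \<in> S" "y \<in> V" "y \<notin> S" "E x y"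
      using assms(2) unfolding graph_connected_def by blast
    have y: "y \<noteq> a" "\<not> E a y" "\<And>w. E a w \<Longrightarrow> \<not> E w y"
      using xy by (auto simp: S_def)
    have x: "x \<noteq> a" "\<not> E a x" using y xy(4) by blast+
    then obtain w where "E a w" "E w x" using xy(1) by (auto simp: S_def)
    then show False using P4_freeD[OF assms(1), of a w x y] x y xy(4) by blast
  qed
  then have "b \<in> S" using assms(4) by simp
  then show thesis using assms(5,6) that by (auto simp: S_def)
qed

text \<open>Induction on \<open>A\<close>. If the common neighbour \<open>v\<close> of
  \<open>B\<close> misses the new vertex \<open>a\<close>, it is replaced by a common neighbour
  \<open>w\<close> of \<open>a\<close> and a single \<open>b\<close> in \<open>B\<close>, which
  turns out to be adjacent to all of \<open>B\<close>.\<close>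

lemma P4_free_connected_common_neighbour:
  assumes p4: "P4_free E" and conn: "graph_connected V E" and sym: "\<And>x y. E x y \<Longrightarrow> E y x"
    and two: "at_least_two V"
    and A: "finite A" "A \<noteq> {}" "independent V E A"
  shows "\<exists>v. \<forall>a\<in>A. E v a"
  using A
proof (induction A rule: finite_ne_induct)
  case (singleton a)
  then have "{a} \<subset> V" using two by (auto simp: independent_def at_least_two_def)
  then obtain y where "E a y" using conn unfolding graph_connected_def by blast
  then show ?case using sym by blast
next
  case (insert a B)
  have ind: "a \<in> V" "B \<subseteq> V" "\<And>x y. x \<in> insert a B \<Longrightarrow> y \<in> insert a B \<Longrightarrow> \<not> E x y"
    using insert.prems by (auto simp: independent_def)
  then obtain v where v: "\<forall>b\<in>B. E v b" using insert.IH by (auto simp: independent_def)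
  show ?case
  proof (cases "E v a")
    case True
    then show ?thesis using v by auto
  next
    case va: False
    obtain b where b: "b \<in> B" using insert.hyps by blast
    have "a \<noteq> v" using v b ind by blast
    have "\<not> E a b" "a \<noteq> b" "b \<in> V" using ind b insert.hyps by auto
    then obtain w where w: "E a w" "E w b"
      using P4_free_connected_diameter[OF p4 conn \<open>a \<in> V\<close>] by blast
    have "E w b'" if b': "b' \<in> B" for b'
    proof (rule ccontr)
      assume n: "\<not> E w b'"
      have *: "\<not> E a b'" "E v b'" "\<not> E a v" "w \<noteq> v" "w \<noteq> b'"
        using ind b' v va w sym by blast+
      show False
      \<comment> \<open>If \<open>w\<close> and \<open>v\<close> are adjacent,
        \<open>a, w, v, b'\<close> is an induced path; otherwise \<open>a, w, b, v\<close> is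
        one.\<close>
      proof (cases "E w v")
        case True
        then show False using P4_freeD[OF p4 w(1), of v b'] * n \<open>a \<noteq> v\<close> by blast
      next
        case False
        then show False
          using P4_freeD[OF p4 w, of v] * \<open>\<not> E a b\<close> \<open>a \<noteq> b\<close> sym v b by blast
      qed
    qed
    then show ?thesis using w sym by auto
  qed
qed

text \<open>Finiteness of all antichains does not bound their sizes, so a maximal one is obtained
  from Zorn's lemma: any two vertices in the union of a chain lie in a common member of the
  chain.\<close>

lemma maximal_independent_exists:
  obtains A where "independent V E A" "\<And>B. independent V E B \<Longrightarrow> A \<subseteq> B \<Longrightarrow> B = A"
proof -
  have "\<exists>A\<in>Collect (independent V E). \<forall>B\<in>Collect (independent V E). A \<subseteq> B \<longrightarrow> B = A"
  proof (rule subset_Zorn')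
    fix C assume "subset.chain (Collect (independent V E)) C"
    then have C: "\<And>X. X \<in> C \<Longrightarrow> independent V E X"
      "\<And>X Y. X \<in> C \<Longrightarrow> Y \<in> C \<Longrightarrow> X \<subseteq> Y \<or> Y \<subseteq> X"
      by (auto simp: subset.chain_def)
    have "\<not> E x y" if xy: "X \<in> C" "x \<in> X" "Y \<in> C" "y \<in> Y" for x y X Y
      using C(1)[OF xy(1)] C(1)[OF xy(3)] C(2)[OF xy(1,3)] xy(2,4)
      unfolding independent_def by blast
    then show "\<Union>C \<in> Collect (independent V E)"
      using C(1) unfolding independent_def by blast
  qed
  then show thesis using that by blast
qed

lemma P4_free_connected_join:
  assumes p4: "P4_free E" and conn: "graph_connected V E" and sym: "\<And>x y. E x y \<Longrightarrow> E y x"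
    and irr: "\<And>x. \<not> E x x" and EV: "\<And>x y. E x y \<Longrightarrow> x \<in> V" and two: "at_least_two V"
    and fin: "\<And>A. independent V E A \<Longrightarrow> finite A"
  obtains S where "S \<subset> V" "S \<noteq> {}" "\<And>x y. x \<in> S \<Longrightarrow> y \<in> V - S \<Longrightarrow> E x y"
proof -
  obtain A where A: "independent V E A" and max: "\<And>B. independent V E B \<Longrightarrow> A \<subseteq> B \<Longrightarrow> B = A"
    using maximal_independent_exists[of V E] by blast
  have dom: "\<exists>a\<in>A. E x a" if x: "x \<in> V" "x \<notin> A" for x
  proof (rule ccontr)
    assume "\<not> (\<exists>a\<in>A. E x a)"
    then have "independent V E (insert x A)"
      using A x irr sym unfolding independent_def by blast
    then show False using max[of "insert x A"] x by blast
  qed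
  have "A \<noteq> {}" using dom two by (auto simp: at_least_two_def)
  then obtain a where a: "a \<in> A" by blast
  define S where "S = {v. \<forall>a\<in>A. E v a}"
  show thesis
  proof
    \<comment> \<open>The chosen vertex \<open>a\<close> of \<open>A\<close> serves twice: elements
      of \<open>S\<close> are adjacent to it and so lie in \<open>V\<close>, and it is not adjacent
      to itself, so \<open>S\<close> is proper.\<close>
    have "S \<subseteq> V" using EV a by (auto simp: S_def)
    moreover have "a \<in> V" "a \<notin> S" using A a irr by (auto simp: S_def independent_def)
    ultimately show "S \<subset> V" by blast
    show "S \<noteq> {}"
      using P4_free_connected_common_neighbour[OF p4 conn sym two fin[OF A] \<open>A \<noteq> {}\<close> A]
      by (auto simp: S_def)
    fix v u assume v: "v \<in> S" and u: "u \<in> V - S"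
    show "E v u"
    proof (rule ccontr)
      assume vu: "\<not> E v u"
      then have "u \<notin> A" using v by (auto simp: S_def)
      then obtain b where b: "b \<in> A" "E u b" using dom u by blast
      obtain c where c: "c \<in> A" "\<not> E u c" using u by (auto simp: S_def)
      have "E c v" "E v b" "E b u" "c \<noteq> b" "\<not> E c b" "v \<noteq> u" "\<not> E c u"
        using v u b c A sym by (auto simp: S_def independent_def)
      then show False using P4_freeD[OF p4, of c v b u] vu by blast
    qed
  qed
qed

section \<open>Comparability graphs and cuts of the order\<close>

definition comparable :: "'a rel \<Rightarrow> 'a \<Rightarrow> 'a \<Rightarrow> bool" where
  "comparable r x y \<longleftrightarrow> strictly_below r x y \<or> strictly_below r y x"

text \<open>Along an induced path the directions of the comparabilities alternate, since two
  consecutive ones in the same direction would give a chord by transitivity. Such a zigzag is an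
  \<open>N\<close>, read from one end or from the other.\<close>

lemma N_free_imp_P4_free:
  assumes po: "Partial_order r" and nf: "N_free r"
  shows "P4_free (comparable r)"
proof -
  have tr: "\<And>x y z. strictly_below r x y \<Longrightarrow> strictly_below r y z \<Longrightarrow> strictly_below r x z"
    and as: "\<And>x y. strictly_below r x y \<Longrightarrow> \<not> strictly_below r y x"
    and ir: "\<And>x. \<not> strictly_below r x x"
    using po unfolding partial_order_on_def preorder_on_def strictly_below_def
    by (metis antisymD transD)+
  have fld: "\<And>x y. strictly_below r x y \<Longrightarrow> x \<in> Field r \<and> y \<in> Field r"
    by (auto simp: strictly_below_def Field_def)
  have N: False
    if s: "strictly_below r a b" "strictly_below r c b" "strictly_below r c d"
    and n: "\<not> comparable r a c" "\<not> comparable r b d" "\<not> comparable r a d" "a \<noteq> c" "b \<noteq> d"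
    for a b c d
  proof -
    have d: "a \<noteq> b" "b \<noteq> c" "c \<noteq> d" "a \<noteq> d" using s n ir by (auto simp: comparable_def)
    have "is_N r a b c d"
      using s n d fld ir as[OF s(1)] as[OF s(2)] as[OF s(3)]
      unfolding is_N_def comparable_def by auto
    then show False using nf unfolding N_free_def by blast
  qed
  show ?thesis
    unfolding P4_free_def
  proof (intro notI, elim exE conjE)
    fix a b c d
    assume e: "comparable r a b" "comparable r b c" "comparable r c d" and d: "a \<noteq> c" "b \<noteq> d"
      and n: "\<not> comparable r a c" "\<not> comparable r b d" "\<not> comparable r a d"
    have n': "\<not> comparable r d b" "\<not> comparable r c a" "\<not> comparable r d a"
      using n by (auto simp: comparable_def)
    consider "strictly_below r a b" "strictly_below r c b" "strictly_below r c d"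
      | "strictly_below r b a" "strictly_below r b c" "strictly_below r d c"
      using e n tr unfolding comparable_def by blast
    then show False
      using N[of a b c d] N[of d c b a] n n' d by cases auto
  qed
qed

text \<open>The lower part \<open>L\<close> is the down-closure of the elements of \<open>S\<close>
  below \<open>a\<close>. Take \<open>z\<close> in \<open>L\<close>, lying below such an
  \<open>x\<close>, and \<open>u\<close> outside \<open>L\<close>. If \<open>u\<close> is in
  \<open>S\<close>, it is not below \<open>a\<close>, hence above it, and \<open>z\<close> reaches
  \<open>u\<close> through \<open>x\<close> and \<open>a\<close>. If not, \<open>u\<close> is
  comparable to \<open>x\<close> but not below it, and \<open>z\<close> reaches \<open>u\<close>
  through \<open>x\<close>.\<close>

lemma join_imp_lower_cut:
  assumes po: "Partial_order r"
    and join: "\<And>x y. x \<in> S \<Longrightarrow> y \<in> Field r - S \<Longrightarrow> comparable r x y"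
    and a: "a \<in> Field r - S" and ex: "x\<^sub>0 \<in> S" "strictly_below r x\<^sub>0 a"
  obtains L where "L \<subset> Field r" "L \<noteq> {}"
    "\<And>x y. x \<in> L \<Longrightarrow> y \<in> Field r - L \<Longrightarrow> strictly_below r x y"
proof -
  have tr: "\<And>x y z. (x, y) \<in> r \<Longrightarrow> (y, z) \<in> r \<Longrightarrow> (x, z) \<in> r"
    and as: "\<And>x y. (x, y) \<in> r \<Longrightarrow> (y, x) \<in> r \<Longrightarrow> x = y"
    and re: "\<And>x. x \<in> Field r \<Longrightarrow> (x, x) \<in> r"
    using po unfolding partial_order_on_def preorder_on_def
    by (blast dest: antisymD transD refl_onD)+
  define L where "L = {z. \<exists>x\<in>S. strictly_below r x a \<and> (z, x) \<in> r}"
  show thesis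
  proof
    have "x\<^sub>0 \<in> L" using ex re by (auto simp: L_def strictly_below_def Field_def)
    then show "L \<noteq> {}" by blast
    have "a \<notin> L" using as by (auto simp: L_def strictly_below_def)
    moreover have "L \<subseteq> Field r" by (auto simp: L_def Field_def)
    ultimately show "L \<subset> Field r" using a by blast
    fix z u assume z: "z \<in> L" and u: "u \<in> Field r - L"
    obtain x where x: "x \<in> S" "strictly_below r x a" "(z, x) \<in> r" using z by (auto simp: L_def)
    have "(z, u) \<in> r"
    proof (cases "u \<in> S")
      case True
      then have "\<not> strictly_below r u a" using u re by (auto simp: L_def)
      then have "(a, u) \<in> r" using join[OF True a] by (auto simp: comparable_def strictly_below_def)
      then show ?thesis using x tr unfolding strictly_below_def by blast
    next
      case False
      then have "comparable r x u" using join x(1) u by blast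
      moreover have "(u, x) \<notin> r" using u x by (auto simp: L_def)
      ultimately show ?thesis using x(3) tr unfolding comparable_def strictly_below_def by blast
    qed
    moreover have "z \<noteq> u" using z u by blast
    ultimately show "strictly_below r z u" by (simp add: strictly_below_def)
  qed
qed

lemma strictly_below_converse: "strictly_below (r\<inverse>) x y \<longleftrightarrow> strictly_below r y x"
  by (auto simp: strictly_below_def)

lemma join_imp_cut:
  assumes po: "Partial_order r" and S: "S \<subset> Field r" "S \<noteq> {}"
    and join: "\<And>x y. x \<in> S \<Longrightarrow> y \<in> Field r - S \<Longrightarrow> comparable r x y"
  obtains L where "L \<subset> Field r" "L \<noteq> {}"
    "\<And>x y. x \<in> L \<Longrightarrow> y \<in> Field r - L \<Longrightarrow> strictly_below r x y"
proof -
  obtain x a where x: "x \<in> S" and a: "a \<in> Field r - S" using S by blast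
  consider "strictly_below r x a" | "strictly_below (r\<inverse>) x a"
    using join[OF x a] by (auto simp: comparable_def strictly_below_converse)
  then show thesis
  proof cases
    case 1
    then show thesis using join_imp_lower_cut[OF po join a x] that by blast
  next
    case 2
    \<comment> \<open>If \<open>x\<close> lies above \<open>a\<close>, the construction is dualised:
      a lower part \<open>U\<close> for the converse order is an upper part for \<open>r\<close>,
      and its complement is the required lower part.\<close>
    have po': "Partial_order (r\<inverse>)" using po by simp
    have join': "comparable (r\<inverse>) u v" if "u \<in> S" "v \<in> Field (r\<inverse>) - S" for u v
      using join[of u v] that by (auto simp: comparable_def strictly_below_converse)
    have a': "a \<in> Field (r\<inverse>) - S" using a by simp
    obtain U where U: "U \<subset> Field r" "U \<noteq> {}"
      "\<And>u v. u \<in> U \<Longrightarrow> v \<in> Field r - U \<Longrightarrow> strictly_below r v u"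
      using join_imp_lower_cut[OF po' join' a' x 2] by (auto simp: strictly_below_converse)
    show thesis
      by (rule that[of "Field r - U"]) (use U in blast)+
  qed
qed

section \<open>Restrictions and sums of two blocks\<close>

lemma Field_Restr_Partial_order:
  assumes "Partial_order r" "X \<subseteq> Field r"
  shows "Field (Restr r X) = X"
  using assms by (auto simp: partial_order_on_def preorder_on_def refl_on_def Field_def)

lemma N_free_Restr:
  assumes "N_free r"
  shows "N_free (Restr r X)"
proof -
  have "is_N r a b c d" if n: "is_N (Restr r X) a b c d" for a b c d
  proof -
    have "{a, b, c, d} \<subseteq> Field (Restr r X)" using n unfolding is_N_def by blast
    then have "{a, b, c, d} \<subseteq> X" "{a, b, c, d} \<subseteq> Field r"
      by (auto simp: Field_def)
    moreover from this have "strictly_below (Restr r X) x y \<longleftrightarrow> strictly_below r x y"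
      if "x \<in> {a, b, c, d}" "y \<in> {a, b, c, d}" for x y
      using that unfolding strictly_below_def by blast
    ultimately show ?thesis using n unfolding is_N_def by (metis (no_types, lifting))
  qed
  then show ?thesis using assms unfolding N_free_def by blast
qed

lemma no_infinite_antichain_Restr:
  assumes "no_infinite_antichain r"
  shows "no_infinite_antichain (Restr r X)"
proof -
  have "antichain_in r A" if "antichain_in (Restr r X) A" for A
  proof -
    have "A \<subseteq> X" "A \<subseteq> Field r" using that by (auto simp: antichain_in_def Field_def)
    then show ?thesis using that unfolding antichain_in_def by blast
  qed
  then show ?thesis using assms unfolding no_infinite_antichain_def by blast
qed

text \<open>The two blocks themselves are the indices, so \<open>Restr r\<close> is the family of
  summands for both kinds of sum and only the order on the indices varies.\<close>

lemma lex_family_Restr: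
  assumes "Partial_order r" "Partial_order I" "Field I = {S, Field r - S}" "S \<subset> Field r" "S \<noteq> {}"
  shows "lex_family I (Restr r)"
proof -
  have F: "\<And>X. X \<in> Field I \<Longrightarrow> Field (Restr r X) = X"
    using assms Field_Restr_Partial_order by fastforce
  have "disjoint_family_on (\<lambda>X. Field (Restr r X)) (Field I)"
    using F assms(3) by (auto simp: disjoint_family_on_def)
  moreover have "Partial_order (Restr r X)" for X
    using assms(1) by (rule Partial_order_Restr)
  moreover have "at_least_two (Field I)" using assms(3-5) by (auto simp: at_least_two_def)
  moreover have "\<forall>X\<in>Field I. X \<noteq> {}" using assms(3-5) by auto
  ultimately show ?thesis using F assms(2) unfolding lex_family_def by metis
qed

lemma disjoint_sum_of_split:
  assumes po: "Partial_order r" and S: "S \<subset> Field r" "S \<noteq> {}"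
    and sep: "\<And>x y. x \<in> S \<Longrightarrow> y \<in> Field r - S \<Longrightarrow> \<not> comparable r x y"
  shows "is_disjoint_sum r {(S, S), (Field r - S, Field r - S)} (Restr r)"
proof -
  let ?T = "Field r - S"
  let ?I = "{(S, S), (?T, ?T)}"
  have FI: "Field ?I = {S, ?T}" by (auto simp: Field_def)
  have "Partial_order ?I"
    unfolding partial_order_on_def preorder_on_def FI
    by (auto simp: refl_on_def trans_def antisym_def)
  then have "lex_family ?I (Restr r)" using lex_family_Restr[OF po _ FI S] by blast
  moreover have "antichain_in ?I (Field ?I)" using S by (auto simp: antichain_in_def FI)
  moreover have "r = lex_sum ?I (Restr r)"
  proof -
    \<comment> \<open>A pair of \<open>r\<close> crossing between the blocks would be a
      comparability excluded by \<open>sep\<close>.\<close>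
    have "(x, y) \<in> Restr r S \<or> (x, y) \<in> Restr r ?T" if "(x, y) \<in> r" for x y
      using sep[of x y] sep[of y x] that FieldI1[OF that] FieldI2[OF that]
      unfolding comparable_def strictly_below_def by blast
    moreover have "\<not> strictly_below ?I X Y" for X Y by (auto simp: strictly_below_def)
    ultimately show ?thesis unfolding lex_sum_def FI by auto
  qed
  ultimately show ?thesis by (simp add: is_disjoint_sum_def)
qed

lemma linear_sum_of_cut:
  assumes po: "Partial_order r" and S: "S \<subset> Field r" "S \<noteq> {}"
    and cut: "\<And>x y. x \<in> S \<Longrightarrow> y \<in> Field r - S \<Longrightarrow> strictly_below r x y"
  shows "is_linear_sum r {(S, S), (S, Field r - S), (Field r - S, Field r - S)} (Restr r)"
proof -
  let ?T = "Field r - S"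
  let ?I = "{(S, S), (S, ?T), (?T, ?T)}"
  \<comment> \<open>Distinct blocks make \<open>?I\<close> a genuine two-element chain with
    \<open>S\<close> strictly below \<open>?T\<close>.\<close>
  have ne: "S \<noteq> ?T" using S by blast
  have FI: "Field ?I = {S, ?T}" by (auto simp: Field_def)
  have I: "Partial_order ?I"
    unfolding partial_order_on_def preorder_on_def FI
    using ne by (auto simp: refl_on_def trans_def antisym_def)
  then have "lex_family ?I (Restr r)" using lex_family_Restr[OF po _ FI S] by blast
  moreover have "Linear_order ?I"
    using I unfolding linear_order_on_def FI by (auto simp: total_on_def)
  moreover have "r = lex_sum ?I (Restr r)"
  proof -
    have F: "Field (Restr r S) = S" "Field (Restr r ?T) = ?T"
      using S by (auto intro!: Field_Restr_Partial_order[OF po])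
    have sb: "strictly_below ?I X Y \<longleftrightarrow> X = S \<and> Y = ?T" for X Y
      using ne by (auto simp: strictly_below_def)
    \<comment> \<open>Antisymmetry excludes pairs from the upper block back to the lower one,
      leaving exactly the three kinds of pairs in the sum.\<close>
    have "(x, y) \<notin> r" if "x \<in> ?T" "y \<in> S" for x y
      using cut[OF that(2,1)] po
      by (auto simp: strictly_below_def partial_order_on_def dest: antisymD)
    then have "(x, y) \<in> r \<longleftrightarrow> (x, y) \<in> Restr r S \<or> (x, y) \<in> Restr r ?T \<or> x \<in> S \<and> y \<in> ?T" for x y
      using cut[of x y] FieldI1[of x y r] FieldI2[of x y r] unfolding strictly_below_def by blast
    then show ?thesis unfolding lex_sum_def FI sb by (auto simp: F)
  qed
  ultimately show ?thesis by (simp add: is_linear_sum_def)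
qed

theorem theorem7:
  fixes r :: "'a rel"
  assumes "Partial_order r"
    and "at_least_two (Field r)"
    and "N_free r"
    and "no_infinite_antichain r"
  shows "\<exists>(I :: 'a set rel) (P :: 'a set \<Rightarrow> 'a rel).
           (is_linear_sum r I P \<or> is_disjoint_sum r I P) \<and>
           (\<forall>i\<in>Field I. N_free (P i) \<and> no_infinite_antichain (P i))"
proof -
  \<comment> \<open>With the summands fixed as restrictions of \<open>r\<close>, both required
    properties of the summands are inherited, whatever \<open>I\<close> is.\<close>
  have "\<exists>I. is_linear_sum r I (Restr r) \<or> is_disjoint_sum r I (Restr r)"
  proof (cases "graph_connected (Field r) (comparable r)")
    case True
    have fin: "finite A" if "independent (Field r) (comparable r) A" for A
    proof -
      have "antichain_in r A"
        using that unfolding independent_def antichain_in_def comparable_def strictly_below_def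
        by blast
      then show ?thesis using assms(4) by (auto simp: no_infinite_antichain_def)
    qed
    obtain S where "S \<subset> Field r" "S \<noteq> {}"
      "\<And>x y. x \<in> S \<Longrightarrow> y \<in> Field r - S \<Longrightarrow> comparable r x y"
      by (rule P4_free_connected_join[OF N_free_imp_P4_free[OF assms(1,3)] True _ _ _ assms(2) fin])
        (auto simp: comparable_def strictly_below_def Field_def)
    then obtain L where "L \<subset> Field r" "L \<noteq> {}"
      "\<And>x y. x \<in> L \<Longrightarrow> y \<in> Field r - L \<Longrightarrow> strictly_below r x y"
      using join_imp_cut[OF assms(1)] by blast
    then show ?thesis using linear_sum_of_cut[OF assms(1)] by blast
  next
    case False
    \<comment> \<open>A set witnessing disconnectedness has no comparability to its complement, so
      it splits \<open>r\<close> into two incomparable blocks.\<close>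
    then obtain S where "S \<subset> Field r" "S \<noteq> {}"
      "\<And>x y. x \<in> S \<Longrightarrow> y \<in> Field r - S \<Longrightarrow> \<not> comparable r x y"
      unfolding graph_connected_def by blast
    then show ?thesis using disjoint_sum_of_split[OF assms(1)] by blast
  qed
  then show ?thesis
    using N_free_Restr[OF assms(3)] no_infinite_antichain_Restr[OF assms(4)] by blast
qed

end
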